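(* Let $H\le F$ be a non-trivial subgroup with exponential growth rate $v_H=\limsup_{n\to\infty}|H\cap B_F^n|^{1/n}$. If $v_H<\sqrt{2m-1}$, then the action of $H$ on $(\partial F,\mathfrak m)$ is completely dissipative.
   Context: $F$ is the free group freely generated by a finite set $\mathcal A$ with $|\mathcal A|=m\ge 2$; elements $g\in F$ are identified with finite freely reduced words in $\mathcal A\sqcup\mathcal A^{-1}$, $|g|$ is the length, and $B_F^n=\{g\in F:|g|\le n\}$. $\partial F$ is the set of infinite freely reduced words with the product topology; $F$ acts on it by concatenation followed by free reduction. The uniform measure $\mathfrak m$ is the Borel probability measure on $\partial F$ for which the set of infinite words beginning with $g$ has measure $\frac1{2m(2m-1)^{|g|-1}}$ for every $g\ne e$; it is quasi-invariant under $F$. A measure class preserving action of a countable group $G$ on a measure space $(\mathcal X,\mu)$ is completely dissipative if $\mathcal X$ is (mod 0) the union of the translates of a wandering set, i.e. of a measurable set $A$ whose translates $gA$, $g\in G$, are pairwise disjoint. *)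

theory Defs
  imports "HOL-Probability.Probability" "HOL-Algebra.Group_Action"
begin

text \<open>The pair \<^term>\<open>(a, True)\<close> stands for the generator \<^term>\<open>a\<close> and
  \<^term>\<open>(a, False)\<close> for its inverse; the free generating set is the whole
  type \<^typ>\<open>'a\<close>.\<close>

type_synonym 'a letter = "'a \<times> bool"

definition inv_letter :: "'a letter \<Rightarrow> 'a letter" where
  "inv_letter x = (fst x, \<not> snd x)"

definition freely_reduced :: "'a letter list \<Rightarrow> bool" where
  "freely_reduced w \<longleftrightarrow> successively (\<lambda>x y. y \<noteq> inv_letter x) w"

fun cons_red :: "'a letter \<Rightarrow> 'a letter list \<Rightarrow> 'a letter list" where
  "cons_red x [] = [x]"
| "cons_red x (y # w) = (if y = inv_letter x then w else x # y # w)"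

definition free_reduction :: "'a letter list \<Rightarrow> 'a letter list" where
  "free_reduction w = foldr cons_red w []"

definition free_group :: "'a letter list monoid" where
  "free_group = \<lparr>carrier = {w. freely_reduced w}, mult = (\<lambda>g h. free_reduction (g @ h)), one = []\<rparr>"

definition growth_rate :: "'a letter list set \<Rightarrow> ereal" where
  "growth_rate H = limsup (\<lambda>n. ereal (root n (real (card {g \<in> H. length g \<le> n}))))"

definition boundary :: "(nat \<Rightarrow> 'a letter) set" where
  "boundary = {\<omega>. \<forall>n. \<omega> (Suc n) \<noteq> inv_letter (\<omega> n)}"

definition boundary_topology :: "(nat \<Rightarrow> 'a letter) topology" where
  "boundary_topology =
     subtopology (product_topology (\<lambda>_. discrete_topology UNIV) UNIV) boundary"

definition boundary_borel :: "(nat \<Rightarrow> 'a letter) measure" where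
  "boundary_borel = sigma boundary {U. openin boundary_topology U}"

definition inf_cons_red :: "'a letter \<Rightarrow> (nat \<Rightarrow> 'a letter) \<Rightarrow> nat \<Rightarrow> 'a letter" where
  "inf_cons_red x \<omega> = (if \<omega> 0 = inv_letter x then (\<lambda>n. \<omega> (Suc n)) else case_nat x \<omega>)"

text \<open>As \<^term>\<open>\<omega>\<close> is already reduced, prefixing the letters of \<^term>\<open>g\<close> one at a time,
  starting with the last one, and cancelling whenever possible yields the free reduction of the
  concatenation. Values outside the boundary are undefined because \<^const>\<open>group_action\<close>
  asks for extensional maps.\<close>

definition boundary_action ::
    "'a letter list \<Rightarrow> (nat \<Rightarrow> 'a letter) \<Rightarrow> nat \<Rightarrow> 'a letter" where
  "boundary_action g = (\<lambda>\<omega>\<in>boundary. foldr inf_cons_red g \<omega>)"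

definition cylinder :: "'a letter list \<Rightarrow> (nat \<Rightarrow> 'a letter) set" where
  "cylinder g = {\<omega> \<in> boundary. \<forall>i < length g. \<omega> i = g ! i}"

text \<open>The cylinders, together with the empty set, are a generating system closed under
  intersections, so this determines the measure uniquely.\<close>

definition is_uniform_boundary_measure :: "(nat \<Rightarrow> ('a::finite) letter) measure \<Rightarrow> bool" where
  "is_uniform_boundary_measure M \<longleftrightarrow>
     prob_space M \<and> sets M = sets boundary_borel \<and>
     (\<forall>g. freely_reduced g \<and> g \<noteq> [] \<longrightarrow>
        measure M (cylinder g) =
          1 / (2 * real CARD('a) * (2 * real CARD('a) - 1) ^ (length g - 1)))"

definition measure_class_preserving_action ::
    "('g, 'b) monoid_scheme \<Rightarrow> ('g \<Rightarrow> 'x \<Rightarrow> 'x) \<Rightarrow> 'x measure \<Rightarrow> bool" where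
  "measure_class_preserving_action G \<phi> M \<longleftrightarrow>
     countable (carrier G) \<and> group_action G (space M) \<phi> \<and>
     (\<forall>g \<in> carrier G. \<phi> g \<in> measurable M M \<and> null_sets (distr M M (\<phi> g)) = null_sets M)"

definition wandering_set ::
    "('g, 'b) monoid_scheme \<Rightarrow> ('g \<Rightarrow> 'x \<Rightarrow> 'x) \<Rightarrow> 'x measure \<Rightarrow> 'x set \<Rightarrow> bool" where
  "wandering_set G \<phi> M A \<longleftrightarrow>
     A \<in> sets M \<and> disjoint_family_on (\<lambda>g. \<phi> g ` A) (carrier G)"

definition completely_dissipative ::
    "('g, 'b) monoid_scheme \<Rightarrow> ('g \<Rightarrow> 'x \<Rightarrow> 'x) \<Rightarrow> 'x measure \<Rightarrow> bool" where
  "completely_dissipative G \<phi> M \<longleftrightarrow>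
     measure_class_preserving_action G \<phi> M \<and>
     (\<exists>A. wandering_set G \<phi> M A \<and> (AE x in M. x \<in> (\<Union>g \<in> carrier G. \<phi> g ` A)))"


lemma inv_letter_inv_letter [simp]: "inv_letter (inv_letter x) = x"
  by (simp add: inv_letter_def)

lemma inv_letter_neq [simp]: "inv_letter x \<noteq> x"
  by (metis inv_letter_def prod.sel(2))

lemma reduced_Nil [simp]: "freely_reduced []"
  by (simp add: freely_reduced_def)

lemma reduced_Cons:
  "freely_reduced (x # w) \<longleftrightarrow> freely_reduced w \<and> (w \<noteq> [] \<longrightarrow> hd w \<noteq> inv_letter x)"
  by (cases w) (auto simp: freely_reduced_def)

lemma reduced_cons_red: "freely_reduced w \<Longrightarrow> freely_reduced (cons_red x w)"
  by (cases w) (auto simp: reduced_Cons)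

lemma reduced_foldr: "freely_reduced w \<Longrightarrow> freely_reduced (foldr cons_red v w)"
  by (induction v) (auto intro: reduced_cons_red)

lemma cons_red_inverse: "freely_reduced w \<Longrightarrow> cons_red x (cons_red (inv_letter x) w) = w"
  by (cases w; cases "tl w") (auto simp: reduced_Cons)

lemma foldr_reduced: "freely_reduced w \<Longrightarrow> foldr cons_red w [] = w"
proof (induction w)
  case (Cons x w)
  then show ?case by (cases w) (auto simp: reduced_Cons)
qed simp

lemma foldr_cons_red: "freely_reduced k \<Longrightarrow> foldr cons_red (cons_red x w) k = cons_red x (foldr cons_red w k)"
  using cons_red_inverse[OF reduced_foldr, of k x] by (cases w) auto

lemma foldr_foldr_cons_red:
  "freely_reduced k \<Longrightarrow> foldr cons_red (foldr cons_red g h) k = foldr cons_red g (foldr cons_red h k)"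
  by (induction g) (auto simp: foldr_cons_red)

lemma mult_free_group: "freely_reduced h \<Longrightarrow> mult free_group g h = foldr cons_red g h"
  by (simp add: free_group_def free_reduction_def foldr_reduced)

lemma foldr_inverse: "freely_reduced k \<Longrightarrow> foldr cons_red (rev (map inv_letter g)) (foldr cons_red g k) = k"
proof (induction g)
  case (Cons x g)
  then show ?case
    using cons_red_inverse[OF reduced_foldr[of k g], of "inv_letter x"] by simp
qed simp

lemma group_free_group: "group free_group"
proof (rule groupI)
  fix g :: "'a letter list" assume g: "g \<in> carrier free_group"
  let ?h = "foldr cons_red (rev (map inv_letter g)) []"
  have "foldr cons_red ?h g = []"
    using g foldr_inverse[of "[]" g] by (simp add: foldr_foldr_cons_red foldr_reduced free_group_def)
  then have "?h \<otimes>\<^bsub>free_group\<^esub> g = \<one>\<^bsub>free_group\<^esub>"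
    using g mult_free_group[of g ?h] by (simp add: free_group_def)
  moreover have "?h \<in> carrier free_group"
    by (simp add: free_group_def reduced_foldr)
  ultimately show "\<exists>h\<in>carrier free_group. h \<otimes>\<^bsub>free_group\<^esub> g = \<one>\<^bsub>free_group\<^esub>"
    by blast
qed (auto simp: free_group_def free_reduction_def reduced_foldr foldr_reduced foldr_foldr_cons_red)

lemma inf_cons_red_boundary: "\<omega> \<in> boundary \<Longrightarrow> inf_cons_red x \<omega> \<in> boundary"
  by (auto simp: boundary_def inf_cons_red_def split: nat.split)

lemma foldr_boundary: "\<omega> \<in> boundary \<Longrightarrow> foldr inf_cons_red g \<omega> \<in> boundary"
  by (induction g) (auto intro: inf_cons_red_boundary)

lemma inf_cons_red_inverse:
  "\<omega> \<in> boundary \<Longrightarrow> inf_cons_red x (inf_cons_red (inv_letter x) \<omega>) = \<omega>"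
  by (auto simp: boundary_def inf_cons_red_def fun_eq_iff split: nat.split)

lemma foldr_inf_cons_red:
  "\<omega> \<in> boundary \<Longrightarrow> foldr inf_cons_red (cons_red x w) \<omega> = inf_cons_red x (foldr inf_cons_red w \<omega>)"
  using inf_cons_red_inverse[OF foldr_boundary, of \<omega> x] by (cases w) auto

lemma foldr_foldr_inf:
  "\<omega> \<in> boundary \<Longrightarrow>
    foldr inf_cons_red (foldr cons_red g h) \<omega> = foldr inf_cons_red g (foldr inf_cons_red h \<omega>)"
  by (induction g) (auto simp: foldr_inf_cons_red)

lemma boundary_action_mult:
  assumes "freely_reduced h" "\<omega> \<in> boundary"
  shows "boundary_action (g \<otimes>\<^bsub>free_group\<^esub> h) \<omega> = boundary_action g (boundary_action h \<omega>)"
  using assms by (simp add: boundary_action_def mult_free_group foldr_foldr_inf foldr_boundary)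

lemma group_action_boundary: "group_action (free_group :: 'a letter list monoid) boundary boundary_action"
proof -
  interpret group "free_group :: 'a letter list monoid" by (rule group_free_group)
  have closed: "boundary_action g \<omega> \<in> boundary" if "\<omega> \<in> boundary" for g :: "'a letter list" and \<omega>
    using that by (simp add: boundary_action_def foldr_boundary)
  have one: "boundary_action \<one>\<^bsub>free_group\<^esub> \<omega> = \<omega>" if "\<omega> \<in> boundary" for \<omega> :: "nat \<Rightarrow> 'a letter"
    using that by (simp add: boundary_action_def free_group_def)
  have mult: "boundary_action (g \<otimes>\<^bsub>free_group\<^esub> h) \<omega> = boundary_action g (boundary_action h \<omega>)"
    if "h \<in> carrier free_group" "\<omega> \<in> boundary"
    for g h :: "'a letter list" and \<omega>
    using that boundary_action_mult[of h \<omega> g] by (simp add: free_group_def)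
  have bij: "bij_betw (boundary_action g) boundary boundary"
    if g: "g \<in> carrier free_group" for g :: "'a letter list"
  proof (rule bij_betw_byWitness[where f' = "boundary_action (inv\<^bsub>free_group\<^esub> g)"])
    show "\<forall>\<omega>\<in>boundary. boundary_action (inv\<^bsub>free_group\<^esub> g) (boundary_action g \<omega>) = \<omega>"
      using g by (auto simp: mult[symmetric] one)
    show "\<forall>\<omega>\<in>boundary. boundary_action g (boundary_action (inv\<^bsub>free_group\<^esub> g) \<omega>) = \<omega>"
      using g by (auto simp: mult[symmetric] one)
  qed (use closed in auto)
  have ext: "boundary_action g \<in> extensional boundary" for g :: "'a letter list"
    by (simp add: boundary_action_def)
  have Bij: "boundary_action g \<in> Bij boundary" if "g \<in> carrier free_group" for g :: "'a letter list"
    using that bij ext by (simp add: Bij_def)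
  have "boundary_action (g \<otimes>\<^bsub>free_group\<^esub> h) =
      compose boundary (boundary_action g) (boundary_action h)" if "h \<in> carrier free_group"
    for g h :: "'a letter list"
    using that mult by (intro extensionalityI[of _ boundary]) (auto simp: compose_def boundary_action_def)
  with Bij have "boundary_action \<in> hom (free_group :: 'a letter list monoid) (BijGroup boundary)"
    by (auto simp: hom_def BijGroup_def)
  then show ?thesis
    by (simp add: group_action_def group_hom_def group_hom_axioms_def group_BijGroup group_free_group)
qed

lemma topspace_boundary: "topspace boundary_topology = boundary"
  by (simp add: boundary_topology_def)

lemma space_uniform_boundary_measure:
  assumes "is_uniform_boundary_measure M"
  shows "space M = boundary"
proof -
  have "space M = space boundary_borel"
    using assms by (intro sets_eq_imp_space_eq) (simp add: is_uniform_boundary_measure_def)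
  then show ?thesis
    by (simp add: boundary_borel_def space_measure_of_conv)
qed

end

theory Submission
  imports Defs "HOL-Library.Fun_Lexorder"
begin

text \<open>Cancelling the letters of \<^term>\<open>g\<close> against a boundary point \<^term>\<open>\<omega>\<close> defines an integer
  cocycle, the Busemann cocycle, which is \<^term>\<open>length g\<close> minus twice the number of cancelled
  letters. It is non-positive only if \<^term>\<open>\<omega>\<close> begins with the first half of the inverse of
  \<^term>\<open>g\<close>, an event whose probability is at most \<open>(2m - 1)\<close> to the power
  \<open>- length g / 2\<close>. Below the critical growth these probabilities are summable over
  \<^term>\<open>H\<close>, so by Borel--Cantelli the cocycle is non-positive at almost every point for only
  finitely many elements of \<^term>\<open>H\<close>, and its minimum over \<^term>\<open>H\<close> is attained finitely
  often. Choosing the lexicographically least among the minimising points of each orbit gives a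
  wandering set; there are no ties left because a non-trivial element fixing a boundary point has
  non-zero cocycle there.\<close>

section \<open>Cancellation and the Busemann cocycle\<close>

lemma boundary_step: "\<omega> \<in> boundary \<Longrightarrow> \<omega> (Suc n) \<noteq> inv_letter (\<omega> n)"
  by (simp add: boundary_def)

text \<open>In the usual normalisation this is the Busemann function of \<^term>\<open>\<omega>\<close> at the inverse
  of \<^term>\<open>g\<close>.\<close>

primrec busemann :: "'a letter list \<Rightarrow> (nat \<Rightarrow> 'a letter) \<Rightarrow> int" where
  "busemann [] \<omega> = 0"
| "busemann (x # g) \<omega> =
     busemann g \<omega> + (if foldr inf_cons_red g \<omega> 0 = inv_letter x then - 1 else 1)"

text \<open>When \<open>x\<close> cancels the head of \<open>w\<close>, the contributions of these
  two letters are \<open>1\<close> and \<open>- 1\<close> in some order, because a boundary point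
  has no inverse neighbours; so they add up to zero.\<close>

lemma busemann_cons_red:
  assumes "\<omega> \<in> boundary"
  shows "busemann (cons_red x w) \<omega> =
    busemann w \<omega> + (if foldr inf_cons_red w \<omega> 0 = inv_letter x then - 1 else 1)"
proof (cases w)
  case (Cons y v)
  have "foldr inf_cons_red v \<omega> 1 \<noteq> inv_letter (foldr inf_cons_red v \<omega> 0)"
    using foldr_boundary[OF assms, of v] by (simp add: boundary_def)
  then show ?thesis
    by (auto simp: Cons inf_cons_red_def)
qed simp

text \<open>The cocycle identity: it turns comparisons of values along an orbit into values at
  another point of the orbit.\<close>

lemma busemann_mult:
  assumes "\<omega> \<in> boundary"
  shows "busemann (foldr cons_red g h) \<omega> = busemann g (foldr inf_cons_red h \<omega>) + busemann h \<omega>"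
  using assms by (induction g) (auto simp: busemann_cons_red foldr_foldr_inf)

text \<open>Here \<open>c\<close> counts the cancelled letters. They form a final block of
  \<open>g\<close>, because in a reduced word every letter to the left of a surviving one survives
  as well.\<close>

lemma reduced_action:
  assumes "freely_reduced g" "\<omega> \<in> boundary"
  obtains c where "c \<le> length g"
    and "\<And>i. i < c \<Longrightarrow> \<omega> i = inv_letter (g ! (length g - 1 - i))"
    and "\<And>i. foldr inf_cons_red g \<omega> i =
      (if i < length g - c then g ! i else \<omega> (i - (length g - c) + c))"
    and "busemann g \<omega> = int (length g) - 2 * int c"
  using assms
proof (induction g arbitrary: thesis)
  case Nil
  show ?case by (rule Nil(1)[of 0]) auto
next
  case (Cons x g)
  from Cons.prems have "freely_reduced g" by (simp add: reduced_Cons)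
  then obtain c where c: "c \<le> length g"
      "\<And>i. i < c \<Longrightarrow> \<omega> i = inv_letter (g ! (length g - 1 - i))"
      "\<And>i. foldr inf_cons_red g \<omega> i =
        (if i < length g - c then g ! i else \<omega> (i - (length g - c) + c))"
      "busemann g \<omega> = int (length g) - 2 * int c"
    using Cons.IH Cons.prems(3) by blast
  have nth: "(x # g) ! (length (x # g) - 1 - i) = g ! (length g - 1 - i)" if "i < c" for i
    using that c(1) by (auto simp: nth_Cons split: nat.split intro!: arg_cong[where f = "nth g"])
  show ?case
  proof (cases "foldr inf_cons_red g \<omega> 0 = inv_letter x")
    case True
    \<comment> \<open>If some letter of \<open>g\<close> survived, the image would begin with the
      head of \<open>g\<close>, which reducedness of \<open>x # g\<close> forbids to be
      \<open>inv_letter x\<close>.\<close>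
    have len: "c = length g"
    proof (rule ccontr)
      assume "c \<noteq> length g"
      then have "g \<noteq> []" "g ! 0 = inv_letter x" using True c(1) c(3)[of 0] by auto
      then show False using Cons.prems(2) by (simp add: reduced_Cons hd_conv_nth)
    qed
    show ?thesis
    proof (rule Cons.prems(1)[of "Suc c"])
      fix i assume "i < Suc c"
      then consider "i < c" | "i = c" by linarith
      then show "\<omega> i = inv_letter ((x # g) ! (length (x # g) - 1 - i))"
        by cases (use nth c(2) True c(3)[of 0] len in auto)
    next
      fix i
      show "foldr inf_cons_red (x # g) \<omega> i =
          (if i < length (x # g) - Suc c then (x # g) ! i else \<omega> (i - (length (x # g) - Suc c) + Suc c))"
        using True len by (simp add: inf_cons_red_def[of x] c(3))
    next
      show "busemann (x # g) \<omega> = int (length (x # g)) - 2 * int (Suc c)"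
        using True by (simp add: c(4))
    qed (simp add: len)
  next
    case False
    show ?thesis
    proof (rule Cons.prems(1)[of c])
      fix i
      show "foldr inf_cons_red (x # g) \<omega> i =
          (if i < length (x # g) - c then (x # g) ! i else \<omega> (i - (length (x # g) - c) + c))"
        using False c(1) by (cases i) (simp_all add: inf_cons_red_def[of x] Suc_diff_le c(3))
    next
      show "busemann (x # g) \<omega> = int (length (x # g)) - 2 * int c"
        using False by (simp add: c(4))
    next
      fix i assume "i < c"
      then show "\<omega> i = inv_letter ((x # g) ! (length (x # g) - 1 - i))"
        using nth c(2) by presburger
    qed (use c(1) in simp)
  qed
qed

text \<open>Value zero means that exactly half of \<open>g\<close> cancels. Comparing the last
  surviving letter with the same letter of the fixed point makes the two middle letters of
  \<open>g\<close> mutually inverse.\<close>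

lemma fixed_point_busemann_eq_0:
  assumes g: "freely_reduced g" and \<omega>: "\<omega> \<in> boundary"
    and fixed: "foldr inf_cons_red g \<omega> = \<omega>" and zero: "busemann g \<omega> = 0"
  shows "g = []"
proof (rule ccontr)
  assume "g \<noteq> []"
  obtain c where c: "\<And>i. i < c \<Longrightarrow> \<omega> i = inv_letter (g ! (length g - 1 - i))"
      "\<And>i. foldr inf_cons_red g \<omega> i =
        (if i < length g - c then g ! i else \<omega> (i - (length g - c) + c))"
      "busemann g \<omega> = int (length g) - 2 * int c"
    using reduced_action[OF g \<omega>] by metis
  have len: "length g = 2 * c" using c(3) zero by linarith
  with \<open>g \<noteq> []\<close> have "0 < c" by (cases c) auto
  have "g ! (c - 1) = inv_letter (g ! c)"
    using c(1)[of "c - 1"] c(2)[of "c - 1"] fixed \<open>0 < c\<close> len by (simp add: mult_2)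
  moreover have "g ! c \<noteq> inv_letter (g ! (c - 1))"
    using g \<open>0 < c\<close> len unfolding freely_reduced_def successively_conv_nth by (auto dest: spec[of _ "c - 1"])
  ultimately show False by simp
qed

lemma busemann_nonpos_imp_cylinder:
  assumes g: "freely_reduced g" and \<omega>: "\<omega> \<in> boundary" and "busemann g \<omega> \<le> 0"
  shows "\<omega> \<in> cylinder (take (Suc (length g) div 2) (rev (map inv_letter g)))"
proof -
  obtain c where c: "c \<le> length g" "\<And>i. i < c \<Longrightarrow> \<omega> i = inv_letter (g ! (length g - 1 - i))"
      "busemann g \<omega> = int (length g) - 2 * int c"
    using reduced_action[OF g \<omega>] by metis
  \<comment> \<open>\<open>Suc n div 2\<close> is \<open>n / 2\<close> rounded up.\<close>
  have "Suc (length g) div 2 \<le> c" using c(3) assms(3) by linarith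
  then show ?thesis using \<omega> c by (auto simp: cylinder_def rev_nth)
qed

section \<open>Cylinders and the Borel sets of the boundary\<close>

lemma cylinder_imp_reduced:
  assumes "\<omega> \<in> cylinder w"
  shows "freely_reduced w"
  unfolding freely_reduced_def successively_conv_nth
proof (intro allI impI)
  fix i assume "Suc i < length w"
  with assms have "\<omega> (Suc i) = w ! Suc i" "\<omega> i = w ! i" "\<omega> \<in> boundary"
    by (simp_all add: cylinder_def)
  then show "w ! Suc i \<noteq> inv_letter (w ! i)" using boundary_step[of \<omega> i] by simp
qed

lemma mem_cylinder_take: "\<omega> \<in> boundary \<Longrightarrow> \<omega> \<in> cylinder (map \<omega> [0..<n])"
  by (simp add: cylinder_def)

lemma mem_cylinder_Cons:
  "\<omega> \<in> cylinder (y # v) \<longleftrightarrow> \<omega> \<in> boundary \<and> \<omega> 0 = y \<and> (\<forall>i<length v. \<omega> (Suc i) = v ! i)"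
  by (simp add: cylinder_def All_less_Suc2)

text \<open>After a cancellation the image cannot begin with \<open>x\<close>, since the point was
  reduced. So a first letter \<open>x\<close> comes from prefixing and any other first letter from
  cancelling.\<close>

lemma inf_cons_red_vimage_cylinder:
  assumes "freely_reduced (y # v)" "v \<noteq> []"
  shows "inf_cons_red x -` cylinder (y # v) \<inter> boundary =
    (if y = x then cylinder v else cylinder (inv_letter x # y # v))"
proof -
  have "inf_cons_red x \<omega> \<in> cylinder (y # v) \<longleftrightarrow>
      \<omega> \<in> (if y = x then cylinder v else cylinder (inv_letter x # y # v))"
    if \<omega>: "\<omega> \<in> boundary" for \<omega>
  proof -
    have b: "inf_cons_red x \<omega> \<in> boundary" using \<omega> by (rule inf_cons_red_boundary)
    show ?thesis
    proof (cases "\<omega> 0 = inv_letter x")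
      case True
      obtain z u where v: "v = z # u" using assms(2) by (cases v) auto
      have "\<omega> (Suc 0) \<noteq> x"
        using boundary_step[OF \<omega>, of 0] True by auto
      moreover have "z \<noteq> inv_letter y" using assms(1) by (simp add: v reduced_Cons)
      ultimately show ?thesis
        using True \<omega> b by (auto simp: v mem_cylinder_Cons inf_cons_red_def All_less_Suc2)
    next
      case False
      then show ?thesis
        using \<omega> b by (auto simp: mem_cylinder_Cons inf_cons_red_def) (simp_all add: cylinder_def)
    qed
  qed
  moreover have "cylinder w \<subseteq> boundary" for w :: "'a letter list" by (auto simp: cylinder_def)
  ultimately show ?thesis by (cases "y = x") fastforce+
qed

text \<open>The generating system leaves out the cylinders of length 1 because the preimage of
  \<^term>\<open>cylinder [x]\<close> under \<^term>\<open>inf_cons_red x\<close> is not a cylinder.\<close>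

lemma long_cylinder_cases:
  assumes "Y \<in> insert {} (cylinder ` {w. freely_reduced w \<and> 2 \<le> length w})"
  obtains "Y = {}" | y v where "Y = cylinder (y # v)" "freely_reduced (y # v)" "v \<noteq> []"
proof (cases "Y = {}")
  case False
  then obtain w where w: "Y = cylinder w" "freely_reduced w" "2 \<le> length w" using assms by blast
  then show ?thesis using that(2)[of "hd w" "tl w"] by (cases w; cases "tl w") auto
qed (use that in simp)

text \<open>There are only countably many cylinders, and each open set is the union of the long ones
  it contains.\<close>

lemma sets_boundary_borel:
  "sets (boundary_borel :: (nat \<Rightarrow> 'a::finite letter) measure) =
    sigma_sets boundary (insert {} (cylinder ` {w. freely_reduced w \<and> 2 \<le> length w}))"
    (is "_ = sigma_sets boundary ?E")
proof -
  let ?T = "product_topology (\<lambda>_::nat. discrete_topology (UNIV :: 'a letter set)) UNIV"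
  interpret E: sigma_algebra boundary "sigma_sets boundary ?E"
    by (rule sigma_algebra_sigma_sets) (auto simp: cylinder_def)
  have cyl_open: "openin boundary_topology (cylinder w)" for w :: "'a letter list"
  proof -
    have "openin ?T (\<Pi>\<^sub>E i\<in>UNIV. if i < length w then {w ! i} else UNIV)"
      by (rule product_topology_basis) auto
    moreover have "cylinder w = (\<Pi>\<^sub>E i\<in>UNIV. if i < length w then {w ! i} else UNIV) \<inter> boundary"
      by (auto simp: cylinder_def split: if_splits)
    ultimately show ?thesis
      unfolding boundary_topology_def openin_subtopology by blast
  qed
  have open_sigma: "U \<in> sigma_sets boundary ?E" if U: "openin boundary_topology U" for U
  proof -
    obtain V where V: "openin ?T V" "U = V \<inter> boundary"
      using U unfolding boundary_topology_def openin_subtopology by blast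
    let ?C = "{C \<in> ?E. C \<subseteq> U}"
    have "\<omega> \<in> \<Union>?C" if \<omega>: "\<omega> \<in> U" for \<omega>
    proof -
      obtain X where X: "\<omega> \<in> (\<Pi>\<^sub>E i\<in>UNIV. X i)" "finite {i. X i \<noteq> UNIV}" "(\<Pi>\<^sub>E i\<in>UNIV. X i) \<subseteq> V"
        using product_topology_open_contains_basis[OF V(1), of \<omega>] \<omega> V(2) by auto
      from X(2) obtain n where n: "\<And>i. X i \<noteq> UNIV \<Longrightarrow> i < n"
        by (metis (mono_tags) finite_nat_set_iff_bounded mem_Collect_eq)
      \<comment> \<open>The bound \<open>n\<close> covers all coordinates restricted by
        \<open>X\<close>; adding 2 makes the word long enough for the generating system.\<close>
      let ?w = "map \<omega> [0..<n + 2]"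
      have in_cyl: "\<omega> \<in> cylinder ?w" using \<omega> V(2) by (intro mem_cylinder_take) auto
      have "cylinder ?w \<subseteq> U"
      proof
        fix \<eta> assume \<eta>: "\<eta> \<in> cylinder ?w"
        have "\<eta> i \<in> X i" for i
          using \<eta> X(1) n[of i] by (cases "X i = UNIV") (auto simp: cylinder_def simp del: upt_Suc)
        then show "\<eta> \<in> U" using X(3) V(2) \<eta> by (auto simp: cylinder_def)
      qed
      with in_cyl cylinder_imp_reduced[OF in_cyl] show ?thesis
        by (intro UnionI[of "cylinder ?w"]) (auto simp del: upt_Suc)
    qed
    then have "U = \<Union>?C"
      by (intro subset_antisym Union_least subsetI) (use \<open>\<And>\<omega>. \<omega> \<in> U \<Longrightarrow> \<omega> \<in> \<Union>?C\<close> in blast)+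
    moreover have "countable ?C"
      by (rule countable_subset[OF Collect_restrict]) simp
    moreover have "?C \<subseteq> sigma_sets boundary ?E"
      using sigma_sets_superset_generator[of ?E boundary] Collect_restrict[of ?E] by (rule order_trans[rotated])
    ultimately show ?thesis using E.countable_Union[of ?C] by (simp only:)
  qed
  have "sets (boundary_borel :: (nat \<Rightarrow> 'a letter) measure)
      = sigma_sets boundary {U. openin boundary_topology U}"
    unfolding boundary_borel_def
    by (rule sets_measure_of) (use openin_subset[of boundary_topology] topspace_boundary in auto)
  also have "\<dots> = sigma_sets boundary ?E"
  proof (rule sigma_sets_eqI)
    fix C assume "C \<in> ?E"
    then have "openin boundary_topology C" using cyl_open by auto
    then show "C \<in> sigma_sets boundary {U. openin boundary_topology U}" by (simp add: sigma_sets.Basic)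
  qed (use open_sigma in simp)
  finally show ?thesis .
qed

text \<open>Two cylinders are either nested or disjoint.\<close>

lemma Int_stable_cylinders:
  "Int_stable (insert {} (cylinder ` {w :: 'a letter list. freely_reduced w \<and> 2 \<le> length w}))"
proof -
  have *: "cylinder v \<inter> cylinder w = {} \<or> cylinder v \<inter> cylinder w = cylinder w"
    if "length v \<le> length w" for v w :: "'a letter list"
  proof (cases "\<forall>i<length v. v ! i = w ! i")
    case True
    with that have "cylinder w \<subseteq> cylinder v" by (auto simp: cylinder_def)
    then show ?thesis by blast
  next
    case False
    then obtain i where "i < length v" "v ! i \<noteq> w ! i" by blast
    with that have "cylinder v \<inter> cylinder w = {}"
      by (auto simp: cylinder_def)
    then show ?thesis by blast
  qed
  show ?thesis
  proof (rule Int_stableI, goal_cases)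
    case (1 A B)
    show ?case
    proof (cases "A = {} \<or> B = {}")
      case False
      then obtain v w where vw: "A = cylinder v" "B = cylinder w"
        using 1 by auto
      have "A \<inter> B = {} \<or> A \<inter> B = A \<or> A \<inter> B = B"
        using *[of v w] *[of w v] vw(1,2) by (metis Int_commute nat_le_linear)
      then show ?thesis using 1 by auto
    qed auto
  qed
qed

section \<open>Tie-breaking and the set of minimising points\<close>

text \<open>Letters carry no order of their own; the injective coding \<open>to_nat\<close> supplies
  a linear one.\<close>

definition lex_less :: "(nat \<Rightarrow> 'a::countable) \<Rightarrow> (nat \<Rightarrow> 'a) \<Rightarrow> bool" where
  "lex_less \<omega> \<eta> \<longleftrightarrow> less_fun (to_nat \<circ> \<omega>) (to_nat \<circ> \<eta>)"

lemma lex_less_iff: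
  "lex_less \<omega> \<eta> \<longleftrightarrow> (\<exists>k. to_nat (\<omega> k) < to_nat (\<eta> k) \<and> (\<forall>i<k. \<omega> i = \<eta> i))"
  by (simp add: lex_less_def less_fun_def)

lemma lex_less_asym: "lex_less \<omega> \<eta> \<Longrightarrow> \<not> lex_less \<eta> \<omega>"
  unfolding lex_less_def by (rule less_fun_asym)

lemma lex_less_trans: "lex_less \<omega> \<eta> \<Longrightarrow> lex_less \<eta> \<zeta> \<Longrightarrow> lex_less \<omega> \<zeta>"
  unfolding lex_less_def by (rule less_fun_trans)

lemma lex_less_total:
  assumes "\<omega> \<noteq> \<eta>"
  shows "lex_less \<omega> \<eta> \<or> lex_less \<eta> \<omega>"
proof -
  obtain k where k: "\<omega> k \<noteq> \<eta> k" "\<And>i. i < k \<Longrightarrow> \<omega> i = \<eta> i"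
    using assms exists_least_iff[of "\<lambda>k. \<omega> k \<noteq> \<eta> k"] by (auto simp: fun_eq_iff)
  have "to_nat (\<omega> k) < to_nat (\<eta> k) \<or> to_nat (\<eta> k) < to_nat (\<omega> k)"
    using k(1) by (simp add: nat_neq_iff[symmetric])
  then show ?thesis
    unfolding lex_less_iff
    by (elim disjE) (intro disjI1 exI[of _ k], simp add: k(2), intro disjI2 exI[of _ k], simp add: k(2))
qed

text \<open>Points minimising the Busemann cocycle over their \<^term>\<open>H\<close>-orbit; the lexicographic
  order only breaks ties.\<close>

definition minimal_points :: "'a::finite letter list set \<Rightarrow> (nat \<Rightarrow> 'a letter) set" where
  "minimal_points H = {\<omega> \<in> boundary. \<forall>h\<in>H. h \<noteq> [] \<longrightarrow>
     0 < busemann h \<omega> \<or> busemann h \<omega> = 0 \<and> lex_less \<omega> (foldr inf_cons_red h \<omega>)}"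

lemma subgroup_reduced: "subgroup H free_group \<Longrightarrow> h \<in> H \<Longrightarrow> freely_reduced h"
  using subgroup.subset[of H free_group] by (auto simp: free_group_def)

lemma subgroup_foldr_closed:
  assumes "subgroup H free_group" "g \<in> H" "h \<in> H"
  shows "foldr cons_red g h \<in> H"
  using subgroup.m_closed[OF assms] mult_free_group[OF subgroup_reduced[OF assms(1,3)], of g] by simp

lemma subgroup_Nil: "subgroup H free_group \<Longrightarrow> [] \<in> H"
  using subgroup.one_closed[of H free_group] by (simp add: free_group_def)

lemma subgroup_inverse:
  assumes H: "subgroup H free_group" and h: "h \<in> H"
  obtains k where "k \<in> H" "foldr cons_red k h = []" "foldr cons_red h k = []"
proof -
  interpret group free_group by (rule group_free_group)
  let ?k = "inv\<^bsub>free_group\<^esub> h"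
  have k: "?k \<in> H" using subgroup.m_inv_closed[OF H h] .
  have carrier: "h \<in> carrier free_group" using subgroup.mem_carrier[OF H h] .
  have "?k \<otimes>\<^bsub>free_group\<^esub> h = []" "h \<otimes>\<^bsub>free_group\<^esub> ?k = []"
    using l_inv[OF carrier] r_inv[OF carrier] by (simp_all add: free_group_def)
  with k that show ?thesis
    using mult_free_group[OF subgroup_reduced[OF H h]] mult_free_group[OF subgroup_reduced[OF H k]] by metis
qed

text \<open>The values of \<open>k\<close> at \<open>a\<close> and of its inverse at the image are
  opposite. If both points were minimal, both values would vanish and each point would
  lexicographically precede the other.\<close>

lemma minimal_points_wander:
  assumes H: "subgroup H free_group" and k: "k \<in> H" "k \<noteq> []"
    and a: "a \<in> minimal_points H"
  shows "foldr inf_cons_red k a \<notin> minimal_points H"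
proof
  let ?b = "foldr inf_cons_red k a"
  assume b: "?b \<in> minimal_points H"
  have bd: "a \<in> boundary" using a by (simp add: minimal_points_def)
  obtain l where l: "l \<in> H" "foldr cons_red l k = []" by (rule subgroup_inverse[OF H k(1)])
  have "l \<noteq> []" using l k by auto
  have "foldr inf_cons_red l ?b = a" using foldr_foldr_inf[OF bd, of l k] l by simp
  moreover have "busemann l ?b + busemann k a = 0" using busemann_mult[OF bd, of l k] l by simp
  ultimately show False
    using a b k l(1) \<open>l \<noteq> []\<close> lex_less_asym[of a ?b] unfolding minimal_points_def by fastforce
qed

lemma minimal_points_cover:
  assumes H: "subgroup H free_group" and \<omega>: "\<omega> \<in> boundary"
    and fin: "finite {h \<in> H. busemann h \<omega> \<le> 0}"
  obtains h where "h \<in> H" "foldr inf_cons_red h \<omega> \<in> minimal_points H"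
proof -
  let ?N = "{h \<in> H. busemann h \<omega> \<le> 0}"
  let ?act = "\<lambda>h. foldr inf_cons_red h \<omega>"
  \<comment> \<open>The identity has value 0, so a minimum over \<open>?N\<close> is a minimum over
    all of \<open>H\<close>.\<close>
  have ne: "?N \<noteq> {}" using subgroup_Nil[OF H] by auto
  define m where "m = arg_min_on (\<lambda>h. busemann h \<omega>) ?N"
  have m: "m \<in> ?N" unfolding m_def by (rule arg_min_if_finite(1)[OF fin ne])
  have m_le: "busemann m \<omega> \<le> busemann h \<omega>" if "h \<in> ?N" for h
    unfolding m_def by (rule arg_min_least[OF fin ne that])
  let ?K = "{h \<in> ?N. busemann h \<omega> = busemann m \<omega>}"
  have "finite ?K" by (rule finite_subset[OF _ fin]) blast
  moreover have "?K \<noteq> {}" using m by blast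
  moreover have "asymp_on ?K (\<lambda>g h. lex_less (?act g) (?act h))"
    by (intro asymp_onI) (rule lex_less_asym)
  moreover have "transp_on ?K (\<lambda>g h. lex_less (?act g) (?act h))"
    by (intro transp_onI) (rule lex_less_trans)
  ultimately have "\<exists>h\<in>?K. \<forall>g\<in>?K. g \<noteq> h \<longrightarrow> \<not> lex_less (?act g) (?act h)"
    by (intro Finite_Set.bex_min_element)
  then obtain h where h: "h \<in> ?K" "\<And>g. g \<in> ?K \<Longrightarrow> g \<noteq> h \<Longrightarrow> \<not> lex_less (?act g) (?act h)"
    by (elim bexE) blast
  have bd: "?act h \<in> boundary" using \<omega> by (rule foldr_boundary)
  have "0 < busemann k (?act h) \<or>
      busemann k (?act h) = 0 \<and> lex_less (?act h) (foldr inf_cons_red k (?act h))"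
    if k: "k \<in> H" "k \<noteq> []" for k
  proof -
    let ?g = "foldr cons_red k h"
    have g: "?g \<in> H" using subgroup_foldr_closed[OF H k(1)] h(1) by blast
    have B: "busemann ?g \<omega> = busemann k (?act h) + busemann h \<omega>" by (rule busemann_mult[OF \<omega>])
    have act: "?act ?g = foldr inf_cons_red k (?act h)" by (rule foldr_foldr_inf[OF \<omega>])
    \<comment> \<open>If the value of \<open>k\<close> is not positive, then \<open>?g\<close> lies
      in \<open>?N\<close> and minimality of \<open>m\<close> forces equality.\<close>
    consider "0 < busemann k (?act h)" | "busemann k (?act h) = 0" "?g \<in> ?K"
      using B g h(1) m_le[of ?g] by force
    then show ?thesis
    proof cases
      case 2
      \<comment> \<open>Otherwise \<open>k\<close> would fix a boundary point with value
        zero.\<close>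
      have ne: "?act ?g \<noteq> ?act h"
        using fixed_point_busemann_eq_0[OF subgroup_reduced[OF H k(1)] bd] 2(1) k(2) act by metis
      then have "?g \<noteq> h" by auto
      then have "\<not> lex_less (?act ?g) (?act h)" by (rule h(2)[OF 2(2)])
      with ne show ?thesis using lex_less_total[OF ne] 2(1) act by simp
    qed simp
  qed
  then have "?act h \<in> minimal_points H" using bd by (simp add: minimal_points_def)
  with that h(1) show ?thesis by blast
qed

section \<open>The uniform measure and its quasi-invariance\<close>

locale uniform_boundary =
  fixes M :: "(nat \<Rightarrow> 'a::finite letter) measure"
  assumes uniform: "is_uniform_boundary_measure M"

sublocale uniform_boundary \<subseteq> prob_space M
  using uniform by (simp add: is_uniform_boundary_measure_def)

context uniform_boundary
begin

text \<open>The number of letters that may follow a given one in a reduced word, hence the factor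
  between measures of successive cylinders.\<close>

definition q :: real where "q = 2 * real CARD('a) - 1"

lemma q_ge_1: "1 \<le> q"
  using zero_less_card_finite[where 'a = 'a] by (simp add: q_def Suc_le_eq)

lemma space_M: "space M = boundary"
  by (rule space_uniform_boundary_measure[OF uniform])

lemma sets_M:
  "sets M = sigma_sets boundary (insert {} (cylinder ` {w. freely_reduced w \<and> 2 \<le> length w}))"
  using uniform by (simp add: is_uniform_boundary_measure_def sets_boundary_borel)

lemma measure_cylinder:
  "freely_reduced w \<Longrightarrow> w \<noteq> [] \<Longrightarrow> measure M (cylinder w) = 1 / ((q + 1) * q ^ (length w - 1))"
  using uniform by (simp add: is_uniform_boundary_measure_def q_def)

lemma coordinate_set: "{\<omega> \<in> boundary. \<omega> i = a} \<in> sets M"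
proof -
  \<comment> \<open>Length \<open>i + 2\<close> reaches past position \<open>i\<close> and is never
    below the minimal length 2 of the generators.\<close>
  let ?W = "{w. length w = i + 2 \<and> w ! i = a \<and> freely_reduced w}"
  have "\<omega> \<in> \<Union>(cylinder ` ?W)" if "\<omega> \<in> boundary" "\<omega> i = a" for \<omega>
  proof (rule UN_I)
    show "\<omega> \<in> cylinder (map \<omega> [0..<i + 2])" using that(1) by (rule mem_cylinder_take)
    then show "map \<omega> [0..<i + 2] \<in> ?W"
      using that cylinder_imp_reduced by (auto simp del: upt_Suc)
  qed
  then have "{\<omega> \<in> boundary. \<omega> i = a} = \<Union>(cylinder ` ?W)"
    by (auto simp: cylinder_def)
  also have "\<dots> \<in> sets M"
    by (intro sets.countable_Union) (auto simp: sets_M intro!: sigma_sets.Basic)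
  finally show ?thesis .
qed

lemma measurable_coordinate [measurable]: "(\<lambda>\<omega>. \<omega> i) \<in> measurable M (count_space UNIV)"
proof (rule measurable_count_space_eq_countable[THEN iffD2])
  show "(\<lambda>\<omega>. \<omega> i) \<in> space M \<rightarrow> UNIV \<and> (\<forall>a\<in>UNIV. (\<lambda>\<omega>. \<omega> i) -` {a} \<inter> space M \<in> sets M)"
    using coordinate_set[of i] by (auto simp: space_M vimage_def Int_def conj_commute)
qed auto

lemma sets_cylinder [measurable]: "cylinder w \<in> sets M"
proof -
  have "cylinder w = {\<omega> \<in> space M. \<forall>i<length w. \<omega> i = w ! i}"
    by (simp add: cylinder_def space_M)
  also have "\<dots> \<in> sets M" by measurable
  finally show ?thesis .
qed

lemma measurable_inf_cons_red [measurable]: "inf_cons_red x \<in> measurable M M"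
proof (rule measurable_sigma_sets[OF sets_M])
  fix Y assume "Y \<in> insert {} (cylinder ` {w :: 'a letter list. freely_reduced w \<and> 2 \<le> length w})"
  then show "inf_cons_red x -` Y \<inter> space M \<in> sets M"
  proof (cases Y rule: long_cylinder_cases)
    case (2 y v)
    then show ?thesis by (simp add: space_M inf_cons_red_vimage_cylinder)
  qed simp
qed (auto simp: space_M inf_cons_red_boundary cylinder_def)

text \<open>The Radon-Nikodym derivative of one letter. The preimage of a long cylinder has a word
  one letter shorter if it begins with \<open>x\<close> and one letter longer otherwise; agreement
  on this intersection-stable generator suffices.\<close>

lemma distr_inf_cons_red:
  "distr M M (inf_cons_red x) = density M (\<lambda>\<omega>. ennreal (if \<omega> 0 = x then q else 1 / q))"
  (is "?D = density M ?f")
proof (rule measure_eqI_generator_eq_countable[OF Int_stable_cylinders])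
  let ?E = "insert {} (cylinder ` {w :: 'a letter list. freely_reduced w \<and> 2 \<le> length w})"
  show "?E \<subseteq> Pow boundary" by (auto simp: cylinder_def)
  show "sets ?D = sigma_sets boundary ?E" "sets (density M ?f) = sigma_sets boundary ?E"
    by (simp_all add: sets_M)
  show "?E \<subseteq> ?E" "countable ?E" by auto
  have "\<omega> \<in> \<Union>?E" if "\<omega> \<in> boundary" for \<omega> :: "nat \<Rightarrow> 'a letter"
    using mem_cylinder_take[OF that, of 2] cylinder_imp_reduced[OF mem_cylinder_take[OF that, of 2]]
    by (intro UnionI[of "cylinder (map \<omega> [0..<2])"]) auto
  then show "\<Union>?E = boundary" by (auto simp: cylinder_def)
  interpret D: prob_space ?D by (rule prob_space_distr) simp
  show "emeasure ?D A \<noteq> \<infinity>" for A using D.emeasure_finite[of A] by simp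
  fix Y assume "Y \<in> ?E"
  then show "emeasure ?D Y = emeasure (density M ?f) Y"
  proof (cases Y rule: long_cylinder_cases)
    case (2 y v)
    obtain z u where v: "v = z # u" using 2 by (cases v) auto
    have "inf_cons_red x -` Y \<inter> space M =
        (if y = x then cylinder v else cylinder (inv_letter x # y # v))"
      using 2 by (simp add: space_M inf_cons_red_vimage_cylinder)
    moreover have "measure M \<dots> = (if y = x then q else 1 / q) * measure M Y"
      using 2 q_ge_1 by (simp add: v measure_cylinder reduced_Cons divide_simps)
    ultimately have "emeasure ?D Y = ennreal (if y = x then q else 1 / q) * emeasure M Y"
      using 2 q_ge_1 by (simp add: emeasure_distr emeasure_eq_measure ennreal_mult)
    also have "\<dots> = (\<integral>\<^sup>+ \<omega>. ennreal (if y = x then q else 1 / q) * indicator Y \<omega> \<partial>M)"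
      using 2 by (simp add: nn_integral_cmult_indicator)
    also have "\<dots> = (\<integral>\<^sup>+ \<omega>. ?f \<omega> * indicator Y \<omega> \<partial>M)"
      using 2 by (intro nn_integral_cong) (auto simp: cylinder_def indicator_def)
    also have "\<dots> = emeasure (density M ?f) Y"
      using 2 by (subst emeasure_density) auto
    finally show ?thesis .
  qed simp
qed

text \<open>The density is positive everywhere.\<close>

lemma null_sets_distr_inf_cons_red: "null_sets (distr M M (inf_cons_red x)) = null_sets M"
proof -
  have pos: "ennreal (if \<omega> 0 = x then q else 1 / q) \<noteq> 0" for \<omega> :: "nat \<Rightarrow> 'a letter"
    using q_ge_1 by simp
  have "A \<in> null_sets (distr M M (inf_cons_red x)) \<longleftrightarrow> A \<in> sets M \<and> (AE \<omega> in M. \<omega> \<notin> A)" for A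
    unfolding distr_inf_cons_red by (subst null_sets_density_iff) (simp_all only: pos simp_thms, measurable)
  moreover have "A \<in> null_sets M \<longleftrightarrow> A \<in> sets M \<and> (AE \<omega> in M. \<omega> \<notin> A)" for A
    using AE_iff_null_sets[of A M] null_setsD2[of A M] by blast
  ultimately show ?thesis by blast
qed

lemma measurable_foldr_inf_cons_red [measurable]: "foldr inf_cons_red g \<in> measurable M M"
  by (induction g) (auto intro: measurable_comp)

lemma null_sets_distr_foldr: "null_sets (distr M M (foldr inf_cons_red g)) = null_sets M"
proof (induction g)
  case Nil
  have "foldr inf_cons_red [] = (\<lambda>\<omega> :: nat \<Rightarrow> 'a letter. \<omega>)" by (simp add: fun_eq_iff)
  then show ?case by (simp only: distr_id)
next
  case (Cons x g)
  let ?D = "distr M M (foldr inf_cons_red g)"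
  have "foldr inf_cons_red (x # g) = inf_cons_red x \<circ> foldr inf_cons_red g" by (simp add: fun_eq_iff)
  then have *: "distr M M (foldr inf_cons_red (x # g)) = distr ?D M (inf_cons_red x)"
    using distr_distr[OF measurable_inf_cons_red[of x] measurable_foldr_inf_cons_red[of g]] by (simp only:)
  have "inf_cons_red x \<in> measurable ?D M"
    by (simp only: measurable_distr_eq1 measurable_inf_cons_red)
  \<comment> \<open>Nullity of a preimage is the same for \<open>?D\<close> and \<open>M\<close> by
    the induction hypothesis.\<close>
  then have "A \<in> null_sets (distr ?D M (inf_cons_red x)) \<longleftrightarrow>
      A \<in> null_sets (distr M M (inf_cons_red x))" for A
    using null_sets_distr_iff[of "inf_cons_red x" ?D M A] null_sets_distr_iff[of "inf_cons_red x" M M A]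
      measurable_inf_cons_red[of x]
    by (simp only: Cons.IH space_distr)
  then show ?case unfolding * using null_sets_distr_inf_cons_red by blast
qed

lemma measure_class_preserving:
  assumes H: "subgroup H free_group"
  shows "measure_class_preserving_action (free_group\<lparr>carrier := H\<rparr>) boundary_action M"
proof -
  have eq: "boundary_action g \<omega> = foldr inf_cons_red g \<omega>" if "\<omega> \<in> space M" for g \<omega>
    using that by (simp add: boundary_action_def space_M)
  have "boundary_action g \<in> measurable M M" for g
    using measurable_foldr_inf_cons_red[of g] by (subst measurable_cong[OF eq])
  moreover have "distr M M (boundary_action g) = distr M M (foldr inf_cons_red g)" for g
    by (intro distr_cong eq) auto
  ultimately show ?thesis
    using group_action.induced_action[OF group_action_boundary H]
    by (simp add: measure_class_preserving_action_def space_M null_sets_distr_foldr)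
qed

section \<open>Measurability of the minimising points\<close>

lemma measurable_busemann: "(\<lambda>\<omega>. real_of_int (busemann g \<omega>)) \<in> borel_measurable M"
proof (induction g)
  case (Cons x g)
  have "(\<lambda>\<omega>. foldr inf_cons_red g \<omega> 0) \<in> measurable M (count_space UNIV)"
    using measurable_compose[OF measurable_foldr_inf_cons_red measurable_coordinate] .
  note [measurable] = this Cons.IH
  show ?case by (simp add: if_distrib[of real_of_int] cong: if_cong)
qed simp

lemma sets_lex_less: "{\<omega> \<in> space M. lex_less \<omega> (foldr inf_cons_red g \<omega>)} \<in> sets M"
proof -
  have [measurable]: "(\<lambda>\<omega>. foldr inf_cons_red g \<omega> i) \<in> measurable M (count_space UNIV)" for i
    using measurable_compose[OF measurable_foldr_inf_cons_red measurable_coordinate] .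
  show ?thesis unfolding lex_less_iff by measurable
qed

lemma sets_minimal_points: "minimal_points H \<in> sets M"
proof -
  have "{\<omega> \<in> space M. 0 < busemann h \<omega> \<or>
      busemann h \<omega> = 0 \<and> lex_less \<omega> (foldr inf_cons_red h \<omega>)} \<in> sets M" for h
  proof -
    note [measurable] = measurable_busemann[of h]
    have "{\<omega> \<in> space M. 0 < real_of_int (busemann h \<omega>)} \<union>
        {\<omega> \<in> space M. real_of_int (busemann h \<omega>) = 0} \<inter>
        {\<omega> \<in> space M. lex_less \<omega> (foldr inf_cons_red h \<omega>)} \<in> sets M"
      by (intro sets.Un sets.Int sets_lex_less; measurable)
    also have "{\<omega> \<in> space M. 0 < real_of_int (busemann h \<omega>)} \<union>
        {\<omega> \<in> space M. real_of_int (busemann h \<omega>) = 0} \<inter>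
        {\<omega> \<in> space M. lex_less \<omega> (foldr inf_cons_red h \<omega>)} =
        {\<omega> \<in> space M. 0 < busemann h \<omega> \<or>
          busemann h \<omega> = 0 \<and> lex_less \<omega> (foldr inf_cons_red h \<omega>)}"
      by auto
    finally show ?thesis .
  qed
  \<comment> \<open>Words over a finite alphabet are countable, so this is a countable
    intersection.\<close>
  then have "{\<omega> \<in> space M. \<forall>h\<in>H - {[]}. 0 < busemann h \<omega> \<or>
      busemann h \<omega> = 0 \<and> lex_less \<omega> (foldr inf_cons_red h \<omega>)} \<in> sets M"
    by (intro sets.sets_Collect_countable_All') auto
  also have "{\<omega> \<in> space M. \<forall>h\<in>H - {[]}. 0 < busemann h \<omega> \<or>
      busemann h \<omega> = 0 \<and> lex_less \<omega> (foldr inf_cons_red h \<omega>)} = minimal_points H"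
    by (auto simp: minimal_points_def space_M)
  finally show ?thesis .
qed

section \<open>Borel-Cantelli below the critical growth\<close>

text \<open>Weakens \<open>q + 1\<close> to \<open>q\<close>. The empty word and words with empty
  cylinder are covered too, which spares side conditions in the summation.\<close>

lemma measure_cylinder_le: "measure M (cylinder w) \<le> 1 / q ^ length w"
proof (cases "w = [] \<or> cylinder w = {}")
  case True
  then show ?thesis using q_ge_1 by auto
next
  case False
  then have "freely_reduced w" using cylinder_imp_reduced by blast
  then have "measure M (cylinder w) = 1 / ((q + 1) * q ^ (length w - 1))"
    using False by (intro measure_cylinder) auto
  also have "\<dots> \<le> 1 / (q * q ^ (length w - 1))"
    using q_ge_1 by (intro divide_left_mono mult_right_mono) auto
  also have "q * q ^ (length w - 1) = q ^ length w"
    using False by (cases w) auto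
  finally show ?thesis .
qed

lemma AE_finite_busemann_nonpos:
  assumes H: "subgroup H free_group" and growth: "growth_rate H < ereal (sqrt q)"
  shows "AE \<omega> in M. finite {h \<in> H. busemann h \<omega> \<le> 0}"
proof -
  let ?c = "\<lambda>g :: 'a letter list. cylinder (take (Suc (length g) div 2) (rev (map inv_letter g)))"
  let ?H = "\<lambda>n. {g \<in> H. length g = n}"
  let ?B = "\<lambda>n. {g \<in> H. length g \<le> n}"
  let ?A = "\<lambda>n. \<Union>g\<in>?H n. ?c g"
  let ?s = "sqrt q"
  have s: "1 \<le> ?s" "?s ^ 2 = q" using q_ge_1 by auto
  have fin: "finite (?B n)" for n
    by (rule finite_subset[OF _ finite_lists_length_le[of UNIV n]]) auto
  have fin': "finite (?H n)" for n
    by (rule finite_subset[OF _ fin[of n]]) auto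
  have c_le: "measure M (?c g) \<le> 1 / ?s ^ length g" for g
  proof -
    have "length (take (Suc (length g) div 2) (rev (map inv_letter g))) = Suc (length g) div 2"
      by simp
    then have "measure M (?c g) \<le> 1 / q ^ (Suc (length g) div 2)"
      using measure_cylinder_le[of "take (Suc (length g) div 2) (rev (map inv_letter g))"] by simp
    also have "q ^ (Suc (length g) div 2) = ?s ^ (2 * (Suc (length g) div 2))"
      by (simp only: power_mult s(2))
    \<comment> \<open>Rounding up makes the exponent at least \<open>length g\<close>, and the base
      is at least 1.\<close>
    also have "1 / \<dots> \<le> 1 / ?s ^ length g"
      using s(1) by (intro divide_left_mono power_increasing) auto
    finally show ?thesis .
  qed
  have A_le: "measure M (?A n) \<le> real (card (?B n)) / ?s ^ n" for n
  proof -
    have "measure M (?A n) \<le> (\<Sum>g\<in>?H n. measure M (?c g))"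
      by (intro finite_measure_subadditive_finite fin') auto
    also have "\<dots> \<le> (\<Sum>g\<in>?H n. 1 / ?s ^ n)"
      using c_le by (intro sum_mono) (metis (mono_tags, lifting) mem_Collect_eq)
    also have "\<dots> = real (card (?H n)) / ?s ^ n" by simp
    \<comment> \<open>The growth rate counts balls, so the sphere is bounded by the ball.\<close>
    also have "\<dots> \<le> real (card (?B n)) / ?s ^ n"
      using s(1) by (intro divide_right_mono of_nat_mono card_mono fin) auto
    finally show ?thesis .
  qed
  obtain r where r: "growth_rate H < ereal r" "r < ?s"
    using ereal_dense2[OF growth] by auto
  \<comment> \<open>Truncation at 0 gives a non-negative ratio \<open>?r / ?s\<close> below 1 for
    the geometric series, whatever the sign of \<open>r\<close>.\<close>
  let ?r = "max r 0"
  have "eventually (\<lambda>n. ereal (root n (real (card (?B n)))) < ereal r) sequentially"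
    using r(1) unfolding growth_rate_def by (rule Limsup_lessD)
  then have "eventually (\<lambda>n. norm (measure M (?A n)) \<le> (?r / ?s) ^ n) sequentially"
    \<comment> \<open>\<open>root 0\<close> is constantly 0, so recovering the cardinality from its
      root requires positive \<open>n\<close>.\<close>
    using eventually_gt_at_top[of 0]
  proof eventually_elim
    case (elim n)
    have "real (card (?B n)) = root n (real (card (?B n))) ^ n"
      using elim(2) by simp
    also have "\<dots> \<le> ?r ^ n"
      using elim by (intro power_mono) auto
    finally have "real (card (?B n)) / ?s ^ n \<le> ?r ^ n / ?s ^ n"
      using s(1) by (intro divide_right_mono) auto
    then show ?case using A_le[of n] by (simp add: power_divide)
  qed
  then have "summable (\<lambda>n. measure M (?A n))"
    using r(2) s(1) by (elim summable_comparison_test_ev) (intro summable_geometric, simp)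
  then have "AE \<omega> in M. eventually (\<lambda>n. \<omega> \<in> space M - ?A n) sequentially"
    by (intro borel_cantelli_AE1) (auto simp: emeasure_eq_measure intro!: sets.finite_UN fin')
  then show ?thesis
  proof eventually_elim
    case (elim \<omega>)
    then obtain N where N: "\<And>n. N \<le> n \<Longrightarrow> \<omega> \<in> space M - ?A n"
      unfolding eventually_sequentially by blast
    then have \<omega>: "\<omega> \<in> boundary" using space_M by blast
    have "length h \<le> N" if h: "h \<in> H" "busemann h \<omega> \<le> 0" for h
    proof (rule ccontr)
      assume "\<not> length h \<le> N"
      then have "\<omega> \<notin> ?A (length h)" using N[of "length h"] by simp
      moreover have "\<omega> \<in> ?c h"
        by (rule busemann_nonpos_imp_cylinder[OF subgroup_reduced[OF H h(1)] \<omega> h(2)])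
      ultimately show False using h(1) by blast
    qed
    then show ?case by (intro finite_subset[OF _ fin[of N]]) auto
  qed
qed

section \<open>Translates of the minimising points\<close>

lemma completely_dissipative_subgroup:
  assumes H: "subgroup H free_group" and growth: "growth_rate H < ereal (sqrt q)"
  shows "completely_dissipative (free_group\<lparr>carrier := H\<rparr>) boundary_action M"
proof -
  let ?A = "minimal_points H"
  have A: "boundary_action g \<omega> = foldr inf_cons_red g \<omega>" if "\<omega> \<in> ?A" for g \<omega>
    using that by (simp add: boundary_action_def minimal_points_def)
  have "boundary_action g ` ?A \<inter> boundary_action h ` ?A = {}"
    if g: "g \<in> H" and h: "h \<in> H" and "g \<noteq> h" for g h
  proof (rule ccontr)
    assume "boundary_action g ` ?A \<inter> boundary_action h ` ?A \<noteq> {}"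
    then obtain a b where ab: "a \<in> ?A" "b \<in> ?A" "foldr inf_cons_red g a = foldr inf_cons_red h b"
      using A by auto
    then have bd: "a \<in> boundary" "b \<in> boundary" by (auto simp: minimal_points_def)
    obtain l where l: "l \<in> H" "foldr cons_red l h = []" "foldr cons_red h l = []"
      by (rule subgroup_inverse[OF H h])
    \<comment> \<open>If the translates by \<open>g\<close> and \<open>h\<close> meet, the quotient
      \<open>?k\<close> carries one minimal point to another, so it must be trivial, contrary to
      \<open>g \<noteq> h\<close>.\<close>
    let ?k = "foldr cons_red l g"
    have "foldr inf_cons_red ?k a = foldr inf_cons_red (foldr cons_red l h) b"
      using ab(3) bd by (simp add: foldr_foldr_inf)
    then have "foldr inf_cons_red ?k a = b" using l by simp
    moreover have "?k \<noteq> []"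
    proof
      assume "?k = []"
      then have "foldr cons_red h [] = foldr cons_red (foldr cons_red h l) g"
        using foldr_foldr_cons_red[OF subgroup_reduced[OF H g], of h l] by simp
      then show False
        using l(3) foldr_reduced[OF subgroup_reduced[OF H h]] \<open>g \<noteq> h\<close> by simp
    qed
    moreover have "?k \<in> H" by (rule subgroup_foldr_closed[OF H l(1) g])
    ultimately show False using minimal_points_wander[OF H _ _ ab(1), of ?k] ab(2) by simp
  qed
  then have "wandering_set (free_group\<lparr>carrier := H\<rparr>) boundary_action M ?A"
    by (simp add: wandering_set_def disjoint_family_on_def sets_minimal_points)
  moreover have "AE \<omega> in M. \<omega> \<in> (\<Union>g\<in>H. boundary_action g ` ?A)"
    using AE_finite_busemann_nonpos[OF assms] AE_space
  proof eventually_elim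
    case (elim \<omega>)
    then have \<omega>: "\<omega> \<in> boundary" by (simp add: space_M)
    obtain h where h: "h \<in> H" "foldr inf_cons_red h \<omega> \<in> ?A"
      by (rule minimal_points_cover[OF H \<omega> elim(1)])
    \<comment> \<open>Since \<open>h\<close> moves the point into \<open>?A\<close>, its inverse
      exhibits the point as lying in a translate of \<open>?A\<close>.\<close>
    obtain l where l: "l \<in> H" "foldr cons_red l h = []" by (rule subgroup_inverse[OF H h(1)])
    have "boundary_action l (foldr inf_cons_red h \<omega>) = \<omega>"
      using A[OF h(2)] foldr_foldr_inf[OF \<omega>, of l h] l(2) by simp
    then have "\<omega> \<in> boundary_action l ` ?A" using h(2) by (metis imageI)
    then show ?case using l(1) by blast
  qed
  ultimately show ?thesis
    using measure_class_preserving[OF H] by (auto simp: completely_dissipative_def)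
qed

end

theorem theorem4p2:
  fixes H :: "('a::finite) letter list set"
    and \<mm> :: "(nat \<Rightarrow> 'a letter) measure"
  assumes "CARD('a) \<ge> 2"
    and "is_uniform_boundary_measure \<mm>"
    and "subgroup H free_group"
    and "H \<noteq> {\<one>\<^bsub>free_group\<^esub>}"
    and "growth_rate H < ereal (sqrt (2 * real CARD('a) - 1))"
  shows "completely_dissipative (free_group\<lparr>carrier := H\<rparr>) boundary_action \<mm>"
proof -
  interpret uniform_boundary \<mm> by unfold_locales (rule assms(2))
  show ?thesis
    using assms(3,5) by (intro completely_dissipative_subgroup) (simp_all add: q_def)
qed

end
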